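(* Let $f:\mathbf E\to\mathbb R$ be convex and differentiable, and let $\Omega\subseteq\mathbf E$ be a nonempty compact $\alpha$-strongly convex set with respect to $\|\cdot\|$ ($\alpha>0$), with diameter $D=\max_{x,y\in\Omega}\|x-y\|$. Assume $f$ is smooth on $\Omega$ with constant $L_f>0$ with respect to $\|\cdot\|$, and that $f$ satisfies the Hölderian error bound condition on $\Omega$ with constants $\theta\in[0,1]$ and $0<c<\infty$. Let $f_*=\min_{x\in\Omega}f(x)$, and let $(x_t)_{t\ge 0}$ be generated by the Frank-Wolfe method from a point $x_0\in\Omega$, with step sizes chosen by Option I or by Option II. Then for every $t\geq 1$, $$f(x_t)-f_*\leq \begin{cases}\dfrac{C}{(t+k)^{1/(1-\theta)}} & \text{if }\theta\in[0,1),\\[2mm] \rho^{t}\,(f(x_0)-f_* ) & \text{if }\theta=1,\end{cases}$$ where, in the case $\theta\in[0,1)$, $k$ and $C$ are any real numbers with $$k\geq \max\left\{\frac{2-2^{1-\theta}}{2^{1-\theta}-1},\,C'\right\},\qquad C\geq \max\left\{\frac{L_fD^2(1+k)^{\frac{1}{1-\theta}}}{2},\;2\left(\frac{C'}{M}\right)^{\frac{1}{1-\theta}}\right\},$$ $$C'=\frac{1}{1-\theta-\theta(2^{1-\theta}-1)},\qquad M=\frac{\alpha}{8cL_f},$$ and, in the case $\theta=1$, $\rho=\max\left\{\frac12,\,1-\frac{\alpha}{8cL_f}\right\}$.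
   Context: $\mathbf E$ is a finite-dimensional real vector space with inner product $u^\top v$ and a norm $\|\cdot\|$ (not necessarily induced by the inner product). Smoothness: $f$ is smooth on $\Omega$ with constant $L_f$ with respect to $\|\cdot\|$ if $f(x)\leq f(y)+\nabla f(y)^\top(x-y)+\frac{L_f}{2}\|x-y\|^2$ for all $x,y\in\Omega$. Strongly convex set: a convex set $\Omega$ is $\alpha$-strongly convex with respect to $\|\cdot\|$ if for all $x,y\in\Omega$, all $\gamma\in[0,1]$ and all $z\in\mathbf E$ with $\|z\|=1$, one has $\gamma x+(1-\gamma)y+\gamma(1-\gamma)\frac{\alpha}{2}\|x-y\|^2z\in\Omega$. Hölderian error bound (HEB) condition: $f$ satisfies it on $\Omega$ with constants $\theta\in[0,1]$ and $0<c<\infty$ if for every $x\in\Omega$, $\min_{w\in\Omega_*}\|x-w\|\leq c(f(x)-f_* )^\theta$, where $\Omega_*$ is the set of minimizers of $f$ over $\Omega$ and $f_*=\min_{x\in\Omega}f(x)$. Frank-Wolfe method: start from $x_0\in\Omega$; for $t=0,1,2,\ldots$ choose $y_t\in\arg\min_{y\in\Omega}\nabla f(x_t)^\top y$; choose the step size $\eta_t$ by Option I: $\eta_t\in\arg\min_{\eta\in[0,1]}f(x_t+\eta(y_t-x_t))$, or Option II: $\eta_t\in\arg\min_{\eta\in[0,1]}\left\{\eta(y_t-x_t)^\top\nabla f(x_t)+\frac{\eta^2L_f}{2}\|y_t-x_t\|^2\right\}$; and set $x_{t+1}=x_t+\eta_t(y_t-x_t)$. *)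

theory Defs
  imports "HOL-Analysis.Analysis"
begin

text \<open>The space is a Euclidean space, whose inner product represents gradients; distances are
  measured by a second norm, which need not come from the inner product.\<close>

definition is_norm :: "('a::real_vector \<Rightarrow> real) \<Rightarrow> bool" where
  "is_norm N \<longleftrightarrow>
     (\<forall>x. 0 \<le> N x) \<and>
     (\<forall>x. N x = 0 \<longleftrightarrow> x = 0) \<and>
     (\<forall>a x. N (a *\<^sub>R x) = \<bar>a\<bar> * N x) \<and>
     (\<forall>x y. N (x + y) \<le> N x + N y)"

definition grad :: "('a::real_inner \<Rightarrow> real) \<Rightarrow> 'a \<Rightarrow> 'a" where
  "grad f x = (THE g. GDERIV f x :> g)"

definition smooth_on_wrt :: "('a::real_inner \<Rightarrow> real) \<Rightarrow> ('a \<Rightarrow> real) \<Rightarrow> 'a set \<Rightarrow> real \<Rightarrow> bool" where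
  "smooth_on_wrt N f \<Omega> L \<longleftrightarrow>
     (\<forall>x\<in>\<Omega>. \<forall>y\<in>\<Omega>. f x \<le> f y + grad f y \<bullet> (x - y) + L / 2 * (N (x - y))\<^sup>2)"

definition strongly_convex_set :: "('a::real_vector \<Rightarrow> real) \<Rightarrow> real \<Rightarrow> 'a set \<Rightarrow> bool" where
  "strongly_convex_set N \<alpha> \<Omega> \<longleftrightarrow>
     convex \<Omega> \<and>
     (\<forall>x\<in>\<Omega>. \<forall>y\<in>\<Omega>. \<forall>\<gamma>\<in>{0..1}. \<forall>z. N z = 1 \<longrightarrow>
        \<gamma> *\<^sub>R x + (1 - \<gamma>) *\<^sub>R y + (\<gamma> * (1 - \<gamma>) * (\<alpha> / 2) * (N (x - y))\<^sup>2) *\<^sub>R z \<in> \<Omega>)"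

text \<open>The infima and suprema below stand for minima and maxima: for nonempty compact \<open>\<Omega>\<close> and
  continuous \<open>f\<close> they are attained, see the lemmas at the end.\<close>

definition diam_wrt :: "('a::real_vector \<Rightarrow> real) \<Rightarrow> 'a set \<Rightarrow> real" where
  "diam_wrt N \<Omega> = (SUP (x, y)\<in>\<Omega> \<times> \<Omega>. N (x - y))"

definition min_value :: "('a \<Rightarrow> real) \<Rightarrow> 'a set \<Rightarrow> real" where
  "min_value f \<Omega> = (INF x\<in>\<Omega>. f x)"

definition minimizers :: "('a \<Rightarrow> real) \<Rightarrow> 'a set \<Rightarrow> 'a set" where
  "minimizers f \<Omega> = {w. is_arg_min f (\<lambda>x. x \<in> \<Omega>) w}"

text \<open>Here \<open>0 powr 0 = 0\<close> while the usual convention is \<open>0\<^sup>0 = 1\<close>. This only concerns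
  \<open>\<theta> = 0\<close> and \<open>x\<close> a minimizer; then the left-hand side is \<open>0\<close> and the inequality holds
  under either convention.\<close>

definition holder_error_bound ::
    "('a::real_vector \<Rightarrow> real) \<Rightarrow> ('a \<Rightarrow> real) \<Rightarrow> 'a set \<Rightarrow> real \<Rightarrow> real \<Rightarrow> bool" where
  "holder_error_bound N f \<Omega> \<theta> c \<longleftrightarrow>
     (\<forall>x\<in>\<Omega>. (INF w\<in>minimizers f \<Omega>. N (x - w)) \<le> c * (f x - min_value f \<Omega>) powr \<theta>)"

definition exact_line_search :: "('a::real_vector \<Rightarrow> real) \<Rightarrow> 'a \<Rightarrow> 'a \<Rightarrow> real \<Rightarrow> bool" where
  "exact_line_search f x y \<eta> \<longleftrightarrow>
     is_arg_min (\<lambda>s. f (x + s *\<^sub>R (y - x))) (\<lambda>s. s \<in> {0..1}) \<eta>"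

definition quadratic_model_step ::
    "('a::real_inner \<Rightarrow> real) \<Rightarrow> ('a \<Rightarrow> real) \<Rightarrow> real \<Rightarrow> 'a \<Rightarrow> 'a \<Rightarrow> real \<Rightarrow> bool" where
  "quadratic_model_step N f L x y \<eta> \<longleftrightarrow>
     is_arg_min (\<lambda>s. s * ((y - x) \<bullet> grad f x) + s\<^sup>2 * L / 2 * (N (y - x))\<^sup>2) (\<lambda>s. s \<in> {0..1}) \<eta>"

text \<open>The argument \<open>step\<close> is the step size rule: \<open>step x y \<eta>\<close> says that \<open>\<eta>\<close> is an admissible
  step size at \<open>x\<close> towards \<open>y\<close>.\<close>

definition frank_wolfe ::
    "('a::real_inner \<Rightarrow> 'a \<Rightarrow> real \<Rightarrow> bool) \<Rightarrow> ('a \<Rightarrow> real) \<Rightarrow> 'a set \<Rightarrow> (nat \<Rightarrow> 'a) \<Rightarrow> bool" where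
  "frank_wolfe step f \<Omega> x \<longleftrightarrow>
     x 0 \<in> \<Omega> \<and>
     (\<exists>y \<eta>. \<forall>t. is_arg_min (\<lambda>v. grad f (x t) \<bullet> v) (\<lambda>v. v \<in> \<Omega>) (y t) \<and>
                step (x t) (y t) (\<eta> t) \<and>
                x (Suc t) = x t + \<eta> t *\<^sub>R (y t - x t))"

lemma GDERIV_grad:
  fixes f :: "'a::euclidean_space \<Rightarrow> real"
  assumes "f differentiable (at x)"
  shows "GDERIV f x :> grad f x"
proof -
  obtain F where F: "(f has_derivative F) (at x)"
    using assms by (auto simp: differentiable_def)
  interpret F: bounded_linear F using F by (rule has_derivative_bounded_linear)
  let ?g = "\<Sum>b\<in>Basis. F b *\<^sub>R b"
  have "F h = h \<bullet> ?g" for h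
  proof -
    have "F h = F (\<Sum>b\<in>Basis. (h \<bullet> b) *\<^sub>R b)" by (simp add: euclidean_representation)
    also have "\<dots> = (\<Sum>b\<in>Basis. (h \<bullet> b) * F b)" by (simp add: F.sum F.scaleR)
    also have "\<dots> = h \<bullet> ?g" by (simp add: inner_sum_right mult.commute)
    finally show ?thesis .
  qed
  then have "F = (\<lambda>h. h \<bullet> ?g)" by (rule ext)
  with F have g: "GDERIV f x :> ?g" by (simp add: gderiv_def)
  have "g' = ?g" if "GDERIV f x :> g'" for g'
  proof -
    have "(\<lambda>h. h \<bullet> g') = (\<lambda>h. h \<bullet> ?g)"
      by (rule has_derivative_unique[OF that[unfolded gderiv_def] g[unfolded gderiv_def]])
    then have "\<forall>h. h \<bullet> g' = h \<bullet> ?g" unfolding fun_eq_iff .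
    then show ?thesis by (simp only: vector_eq_ldot)
  qed
  with g show ?thesis unfolding grad_def by (rule theI)
qed

lemma is_norm_continuous_on:
  fixes N :: "'a::euclidean_space \<Rightarrow> real"
  assumes "is_norm N"
  shows "continuous_on S N"
proof -
  have "convex_on UNIV N"
  proof (rule convex_onI)
    fix t :: real and x y :: 'a
    assume "0 < t" "t < 1"
    have "N ((1 - t) *\<^sub>R x + t *\<^sub>R y) \<le> N ((1 - t) *\<^sub>R x) + N (t *\<^sub>R y)"
      using assms unfolding is_norm_def by blast
    also have "\<dots> = \<bar>1 - t\<bar> * N x + \<bar>t\<bar> * N y"
      using assms unfolding is_norm_def by simp
    finally show "N ((1 - t) *\<^sub>R x + t *\<^sub>R y) \<le> (1 - t) * N x + t * N y"
      using \<open>0 < t\<close> \<open>t < 1\<close> by simp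
  qed simp
  then have "continuous_on UNIV N" by (intro convex_on_continuous) auto
  then show ?thesis by (rule continuous_on_subset) simp
qed

lemma min_value_attained:
  fixes f :: "'a::topological_space \<Rightarrow> real"
  assumes "compact \<Omega>" "\<Omega> \<noteq> {}" "continuous_on \<Omega> f"
  shows "\<exists>w\<in>\<Omega>. min_value f \<Omega> = f w \<and> (\<forall>x\<in>\<Omega>. f w \<le> f x)"
proof -
  obtain w where w: "w \<in> \<Omega>" "\<forall>x\<in>\<Omega>. f w \<le> f x"
    using continuous_attains_inf[OF assms] by blast
  have "min_value f \<Omega> = f w"
    unfolding min_value_def using w by (intro cInf_eq_minimum) auto
  with w show ?thesis by blast
qed

lemma minimizers_alt:
  fixes f :: "'a \<Rightarrow> real"
  shows "minimizers f \<Omega> = {w\<in>\<Omega>. \<forall>x\<in>\<Omega>. f w \<le> f x}"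
  by (auto simp: minimizers_def is_arg_min_linorder)

lemma compact_minimizers:
  fixes f :: "'a::t2_space \<Rightarrow> real"
  assumes "compact \<Omega>" "\<Omega> \<noteq> {}" "continuous_on \<Omega> f"
  shows "compact (minimizers f \<Omega>)" "minimizers f \<Omega> \<noteq> {}"
proof -
  obtain w where w: "w \<in> \<Omega>" "\<forall>x\<in>\<Omega>. f w \<le> f x"
    using continuous_attains_inf[OF assms] by blast
  then show "minimizers f \<Omega> \<noteq> {}" by (auto simp: minimizers_alt)
  have "minimizers f \<Omega> = \<Omega> \<inter> f -` {..f w}"
    unfolding minimizers_alt using w by (auto intro: order_trans)
  moreover have "closed (\<Omega> \<inter> f -` {..f w})"
    using assms(1,3) by (intro continuous_closed_preimage closed_atMost compact_imp_closed)
  then have "compact (\<Omega> \<inter> (\<Omega> \<inter> f -` {..f w}))"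
    using assms(1) by (rule compact_Int_closed[rotated])
  ultimately show "compact (minimizers f \<Omega>)" by (simp add: Int_assoc[symmetric])
qed

lemma dist_minimizers_attained:
  fixes f N :: "'a::euclidean_space \<Rightarrow> real"
  assumes "is_norm N" "compact \<Omega>" "\<Omega> \<noteq> {}" "continuous_on \<Omega> f"
  shows "\<exists>w\<in>minimizers f \<Omega>. (INF w\<in>minimizers f \<Omega>. N (x - w)) = N (x - w)"
proof -
  have "continuous_on (minimizers f \<Omega>) (\<lambda>w. N (x - w))"
    by (rule continuous_on_compose2[OF is_norm_continuous_on[OF assms(1), of UNIV]])
      (auto intro!: continuous_intros)
  from min_value_attained[OF compact_minimizers[OF assms(2-4)] this]
  show ?thesis unfolding min_value_def by blast
qed

lemma diam_wrt_attained:
  fixes N :: "'a::euclidean_space \<Rightarrow> real"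
  assumes "is_norm N" "compact \<Omega>" "\<Omega> \<noteq> {}"
  shows "\<exists>x\<in>\<Omega>. \<exists>y\<in>\<Omega>. diam_wrt N \<Omega> = N (x - y) \<and> (\<forall>u\<in>\<Omega>. \<forall>v\<in>\<Omega>. N (u - v) \<le> N (x - y))"
proof -
  have "continuous_on (\<Omega> \<times> \<Omega>) (\<lambda>p. N (fst p - snd p))"
    by (rule continuous_on_compose2[OF is_norm_continuous_on[OF assms(1), of UNIV]])
      (auto intro!: continuous_intros)
  moreover have "compact (\<Omega> \<times> \<Omega>)" "\<Omega> \<times> \<Omega> \<noteq> {}"
    using assms by (auto intro: compact_Times)
  ultimately have "\<exists>p\<in>\<Omega> \<times> \<Omega>. \<forall>q\<in>\<Omega> \<times> \<Omega>. N (fst q - snd q) \<le> N (fst p - snd p)"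
    by (intro continuous_attains_sup)
  then obtain p where p: "p \<in> \<Omega> \<times> \<Omega>"
      "\<forall>q\<in>\<Omega> \<times> \<Omega>. N (fst q - snd q) \<le> N (fst p - snd p)"
    by (elim bexE)
  have "diam_wrt N \<Omega> = (SUP q\<in>\<Omega> \<times> \<Omega>. N (fst q - snd q))"
    by (simp add: diam_wrt_def case_prod_beta)
  also have "\<dots> = N (fst p - snd p)"
    using p by (intro cSup_eq_maximum imageI) blast+
  finally have "diam_wrt N \<Omega> = N (fst p - snd p)" .
  moreover have "fst p \<in> \<Omega>" "snd p \<in> \<Omega>" using p(1) by auto
  moreover have "N (u - v) \<le> N (fst p - snd p)" if "u \<in> \<Omega>" "v \<in> \<Omega>" for u v
    using p(2)[rule_format, of "(u, v)"] that by simp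
  ultimately show ?thesis by blast
qed

end

theory Submission
  imports Defs
begin

text \<open>
  Write \<open>h\<close> for the primal gap \<open>f x - f_min\<close> at the current iterate \<open>x\<close>, \<open>g\<close> for the gradient of \<open>f\<close>
  there, \<open>y\<close> for the point of \<open>\<Omega>\<close> that minimizes \<open>v \<mapsto> g \<bullet> v\<close>, and \<open>M = \<alpha> / (8 c L)\<close>. Everything follows
  from one contraction,
  \<open>h' \<le> h * max (1/2) (1 - M * h powr (1 - \<theta>))\<close>, which combines three inequalities.

  First, the error bound makes the gradient large away from the minimizers
  (\<open>error_bound_steep_direction\<close>): if \<open>w\<close> is a minimizer closest to \<open>x\<close>, convexity gives
  \<open>h \<le> g \<bullet> (x - w)\<close>, while \<open>N (x - w) \<le> c * h powr \<theta>\<close>; so \<open>g\<close> has slope at least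
  \<open>h powr (1 - \<theta>) / c\<close> along the unit vector in direction \<open>x - w\<close>. Using that vector instead
  of a maximizer of the slope avoids the dual norm.

  Second, strong convexity of \<open>\<Omega>\<close> turns this slope \<open>G\<close> into decrease
  (\<open>strongly_convex_linear_gap\<close>): \<open>\<Omega>\<close> contains the midpoint of \<open>x\<close> and \<open>y\<close> moved by
  \<open>\<alpha>/8 * (N (y - x))\<^sup>2\<close> against the steep direction, and \<open>y\<close> beats this point, so the linear
  gap \<open>g \<bullet> (x - y)\<close> is at least \<open>h/2 + \<alpha>/8 * (N (y - x))\<^sup>2 * G\<close>.

  Third, under either step size rule the new value is at most the quadratic upper model
  at any step size in \<open>{0..1}\<close> (\<open>step_le_quadratic_model\<close>). At step size \<open>\<alpha> * G / (4 * L)\<close>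
  the two terms in \<open>(N (y - x))\<^sup>2\<close> cancel, which leaves the factor \<open>1 - M * h powr (1 - \<theta>)\<close>;
  if this step size exceeds \<open>1\<close>, the full step already halves \<open>h\<close>
  (\<open>frank_wolfe_contraction\<close>).

  For \<open>\<theta> = 1\<close> the contraction factor is at most \<open>\<rho>\<close> and the linear rate is immediate. For
  \<open>\<theta> < 1\<close> the bound is proved by induction from \<open>h\<^sub>1 \<le> L * D\<^sup>2 / 2\<close>, which is the model at the
  full step; the inductive step is the scalar lemma \<open>contraction_power_rate_step\<close>.
\<close>

section \<open>Real powers and the scalar recursion\<close>

lemma powr_Bernoulli_concave:
  fixes a u :: real
  assumes "0 \<le> a" "a \<le> 1" "0 < u"
  shows "u powr a \<le> 1 + a * (u - 1)"
  using Youngs_inequality_0[of a "1 - a" u 1] assms by (simp add: algebra_simps)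

lemma powr_Bernoulli_convex:
  fixes p x :: real
  assumes "1 \<le> p" "0 \<le> 1 + x"
  shows "1 + p * x \<le> (1 + x) powr p"
proof (cases "0 < 1 + p * x")
  case True
  have "(1 + p * x) powr (1 / p) \<le> 1 + x"
    using powr_Bernoulli_concave[of "1 / p" "1 + p * x"] assms True by simp
  then have "((1 + p * x) powr (1 / p)) powr p \<le> (1 + x) powr p"
    using assms by (intro powr_mono2) auto
  with assms True show ?thesis by (simp add: powr_powr)
next
  case False
  then show ?thesis using powr_ge_zero[of "1 + x" p] by linarith
qed

text \<open>Since \<open>2 powr (1 - \<theta>) \<le> 2 - \<theta>\<close>, the denominator in \<open>C'\<close> is at least \<open>(1 - \<theta>)\<^sup>2\<close>, so the
  quotient is not a division by zero; and \<open>2 powr (1 - \<theta>) \<ge> 1\<close> makes \<open>C'\<close> at least the exponent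
  of the rate, the form in which the induction uses it.\<close>

lemma rate_constant_ge:
  fixes \<theta> :: real
  assumes "0 \<le> \<theta>" "\<theta> < 1"
  shows "1 / (1 - \<theta>) \<le> 1 / (1 - \<theta> - \<theta> * (2 powr (1 - \<theta>) - 1))"
proof (rule divide_left_mono)
  have "2 powr (1 - \<theta>) \<le> 1 + (1 - \<theta>)"
    using powr_Bernoulli_concave[of "1 - \<theta>" 2] assms by simp
  then have "\<theta> * (2 powr (1 - \<theta>) - 1) \<le> \<theta> * (1 - \<theta>)"
    using assms by (intro mult_left_mono) auto
  also have "\<dots> < 1 - \<theta>"
    using assms by simp
  finally show "0 < (1 - \<theta>) * (1 - \<theta> - \<theta> * (2 powr (1 - \<theta>) - 1))"
    using assms by simp
  have "1 \<le> 2 powr (1 - \<theta>)"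
    using assms by (intro ge_one_powr_ge_zero) auto
  then show "1 - \<theta> - \<theta> * (2 powr (1 - \<theta>) - 1) \<le> 1 - \<theta>"
    using assms by simp
qed simp

text \<open>The rate \<open>C / s powr (1/a)\<close> loses at most a factor \<open>2\<close> from \<open>s\<close> to \<open>s + 1\<close>, so it survives
  whenever the contraction halves \<open>h\<close>, and also whenever \<open>h\<close> is already below half of the rate.
  Otherwise \<open>M * h powr a\<close> is at least \<open>B / s\<close>, and the factor \<open>1 - B / s\<close> is small enough by
  Bernoulli's inequality. In the application \<open>a = 1 - \<theta>\<close>, \<open>B = C'\<close> and \<open>s = t + k\<close>.\<close>

lemma contraction_power_rate_step:
  fixes a s M B C h h' :: real
  assumes a: "0 < a" "a \<le> 1"
    and s: "0 < s" "1 \<le> s * (2 powr a - 1)"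
    and M: "0 < M" and B: "1 / a \<le> B"
    and C: "2 * (B / M) powr (1 / a) \<le> C"
    and h: "0 \<le> h" "h \<le> C / s powr (1 / a)"
    and h': "h' \<le> h * max (1 / 2) (1 - M * h powr a)"
  shows "h' \<le> C / (s + 1) powr (1 / a)"
proof -
  define p where "p = 1 / a"
  have p: "1 \<le> p" "a * p = 1"
    using a by (auto simp: p_def)
  have E: "0 < s powr p" "0 < (s + 1) powr p"
    using s by auto
  have B0: "0 < B"
    using B p by (simp add: p_def)
  have C0: "0 \<le> C"
    using C powr_ge_zero[of "B / M" "1 / a"] by linarith
  have "(s + 1) powr p \<le> (s * 2 powr a) powr p"
    using s p by (intro powr_mono2) (auto simp: algebra_simps)
  also have "\<dots> = 2 * s powr p"
    using s p by (simp add: powr_mult powr_powr)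
  finally have double: "(s + 1) powr p \<le> 2 * s powr p" .
  have half: "C / s powr p / 2 \<le> C / (s + 1) powr p"
    using divide_left_mono[OF double C0] E by simp
  show ?thesis
  proof (cases "h \<le> C / s powr p / 2 \<or> max (1 / 2) (1 - M * h powr a) = 1 / 2")
    case True
    have "max (1 / 2) (1 - M * h powr a) \<le> 1"
      using M by simp
    then have "h * max (1 / 2) (1 - M * h powr a) \<le> h"
      using h(1) by (rule mult_left_le)
    with h' have stays: "h' \<le> h" by linarith
    from True have "h' \<le> C / s powr p / 2"
    proof
      assume "h \<le> C / s powr p / 2"
      with stays show ?thesis by linarith
    next
      assume "max (1 / 2) (1 - M * h powr a) = 1 / 2"
      with h' have "h' \<le> h / 2" by simp
      also have "\<dots> \<le> C / s powr p / 2"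
        using h(2) unfolding p_def by (intro divide_right_mono) auto
      finally show ?thesis .
    qed
    with half show ?thesis by (simp add: p_def)
  next
    case False
    then have big: "C / s powr p / 2 < h" by simp
    have factor: "max (1 / 2) (1 - M * h powr a) = 1 - M * h powr a"
      using False by (metis max_def)
    have "B / M / s = ((B / M / s) powr p) powr a"
      using B0 M s p by (simp add: powr_powr mult.commute)
    also have "\<dots> = ((B / M) powr p / s powr p) powr a"
      by (simp only: powr_divide)
    also have "\<dots> \<le> h powr a"
    proof (rule powr_mono2)
      have "(B / M) powr p / s powr p \<le> (C / 2) / s powr p"
        using C by (intro divide_right_mono) (auto simp: p_def)
      then show "(B / M) powr p / s powr p \<le> h"
        using big by simp
    qed (use a in auto)
    finally have "M * (B / M / s) \<le> M * h powr a"
      using M by (intro mult_left_mono) auto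
    then have Mh: "B / s \<le> M * h powr a"
      using M by simp
    have pB: "p / (s + 1) \<le> B / s"
      using B B0 s p by (intro frac_le) (auto simp: p_def)
    have "1 - B / s \<le> 1 + p * (- 1 / (s + 1))"
      using pB by simp
    also have "\<dots> \<le> (1 + - 1 / (s + 1)) powr p"
      using s p by (intro powr_Bernoulli_convex) (auto simp: field_simps)
    also have "1 + - 1 / (s + 1) = s / (s + 1)"
      using s by (simp add: field_simps)
    also have "(s / (s + 1)) powr p = s powr p / (s + 1) powr p"
      by (simp add: powr_divide)
    finally have ratio: "1 - B / s \<le> s powr p / (s + 1) powr p" .
    have "h' \<le> h * (1 - M * h powr a)"
      using h' factor by simp
    also have "\<dots> \<le> h * (s powr p / (s + 1) powr p)"
      using h(1) Mh ratio by (intro mult_left_mono) auto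
    also have "\<dots> \<le> C / s powr p * (s powr p / (s + 1) powr p)"
      using h(2) E by (intro mult_right_mono) (auto simp: p_def)
    also have "\<dots> = C / (s + 1) powr p"
      using E by simp
    finally show ?thesis by (simp add: p_def)
  qed
qed

section \<open>Convexity of the function and of the set\<close>

lemma convex_on_ge_gradient:
  fixes f :: "'a::euclidean_space \<Rightarrow> real"
  assumes convex: "convex_on UNIV f" and diff: "f differentiable (at x)"
  shows "f x + grad f x \<bullet> (w - x) \<le> f w"
proof -
  have "convex_on UNIV (\<lambda>s. f (x + s *\<^sub>R (w - x)))"
  proof (rule convex_onI)
    fix t u v :: real
    assume t: "0 < t" "t < 1"
    have "x + ((1 - t) *\<^sub>R u + t *\<^sub>R v) *\<^sub>R (w - x)
        = (1 - t) *\<^sub>R (x + u *\<^sub>R (w - x)) + t *\<^sub>R (x + v *\<^sub>R (w - x))"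
      by (simp add: algebra_simps)
    then show "f (x + ((1 - t) *\<^sub>R u + t *\<^sub>R v) *\<^sub>R (w - x))
        \<le> (1 - t) * f (x + u *\<^sub>R (w - x)) + t * f (x + v *\<^sub>R (w - x))"
      using convex_onD[OF convex, of t] t by simp
  qed simp
  moreover have "((\<lambda>s. f (x + s *\<^sub>R (w - x))) has_field_derivative grad f x \<bullet> (w - x)) (at 0)"
  proof -
    have "(f has_derivative (\<lambda>h. h \<bullet> grad f x)) (at (x + 0 *\<^sub>R (w - x)))"
      using GDERIV_grad[OF diff] by (simp add: gderiv_def)
    then have "((\<lambda>s. f (x + s *\<^sub>R (w - x))) has_derivative (\<lambda>s. (s *\<^sub>R (w - x)) \<bullet> grad f x)) (at 0)"
      by (intro has_derivative_compose[where f = "\<lambda>s. x + s *\<^sub>R (w - x)" and g = f])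
        (auto intro!: derivative_eq_intros)
    then show ?thesis
      by (simp add: has_field_derivative_def inner_commute mult.commute[of _ "_ \<bullet> _"])
  qed
  ultimately have "grad f x \<bullet> (w - x) * (1 - 0)
      \<le> f (x + 1 *\<^sub>R (w - x)) - f (x + 0 *\<^sub>R (w - x))"
    by (intro convex_on_imp_above_tangent[where A = UNIV]) auto
  then show ?thesis by simp
qed

text \<open>The competitor of the linear minimizer \<open>y\<close> is the midpoint of \<open>x\<close> and \<open>y\<close>, moved by the
  amount that strong convexity allows.\<close>

lemma strongly_convex_linear_gap:
  assumes "strongly_convex_set N \<alpha> \<Omega>" "x \<in> \<Omega>"
    and "is_arg_min (\<lambda>v. g \<bullet> v) (\<lambda>v. v \<in> \<Omega>) y" and "N z = 1"
  shows "g \<bullet> (x - y) / 2 + \<alpha> / 8 * (N (y - x))\<^sup>2 * (- (g \<bullet> z)) \<le> g \<bullet> (x - y)"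
proof -
  have y: "y \<in> \<Omega>" and min: "\<And>v. v \<in> \<Omega> \<Longrightarrow> g \<bullet> y \<le> g \<bullet> v"
    using assms(3) by (auto simp: is_arg_min_linorder)
  let ?v = "(1/2) *\<^sub>R y + (1 - 1/2) *\<^sub>R x + (1/2 * (1 - 1/2) * (\<alpha> / 2) * (N (y - x))\<^sup>2) *\<^sub>R z"
  have "(1/2::real) \<in> {0..1}" by simp
  then have "?v \<in> \<Omega>"
    using assms(1,2,4) y unfolding strongly_convex_set_def by blast
  from min[OF this] show ?thesis
    by (simp add: inner_add_right inner_diff_right algebra_simps) argo
qed

section \<open>The error bound and the gradient\<close>

lemma error_bound_steep_direction:
  fixes f N :: "'a::euclidean_space \<Rightarrow> real"
  assumes norm: "is_norm N" and convex: "convex_on UNIV f" and diff: "f differentiable (at x)"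
    and \<Omega>: "compact \<Omega>" "continuous_on \<Omega> f"
    and error_bound: "0 < c" "holder_error_bound N f \<Omega> \<theta> c"
    and x: "x \<in> \<Omega>" "min_value f \<Omega> < f x"
  shows "\<exists>z. N z = 1 \<and> (f x - min_value f \<Omega>) powr (1 - \<theta>) / c \<le> - (grad f x \<bullet> z)"
proof -
  define h where "h = f x - min_value f \<Omega>"
  have h: "0 < h"
    using x by (simp add: h_def)
  have ne: "\<Omega> \<noteq> {}"
    using x by blast
  obtain w where w: "w \<in> minimizers f \<Omega>"
      "(INF w\<in>minimizers f \<Omega>. N (x - w)) = N (x - w)"
    using dist_minimizers_attained[OF norm \<Omega>(1) ne \<Omega>(2), of x] by blast
  have dist: "N (x - w) \<le> c * h powr \<theta>"
    using error_bound(2) x(1) w(2) unfolding holder_error_bound_def h_def by metis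
  have "min_value f \<Omega> = f w"
    using min_value_attained[OF \<Omega>(1) ne \<Omega>(2)] w(1) by (force simp: minimizers_alt)
  then have slope: "h \<le> grad f x \<bullet> (x - w)"
    using convex_on_ge_gradient[OF convex diff, of w]
    by (simp add: h_def inner_diff_right)
  define d where "d = N (x - w)"
  have "x - w \<noteq> 0"
    using slope h by auto
  then have d: "0 < d"
    using norm unfolding d_def is_norm_def by (metis order_le_less)
  define z where "z = (- 1 / d) *\<^sub>R (x - w)"
  have "N z = \<bar>- 1 / d\<bar> * d"
    using norm unfolding z_def d_def is_norm_def by blast
  then have "N z = 1"
    using d by simp
  moreover have "h powr (1 - \<theta>) / c \<le> - (grad f x \<bullet> z)"
  proof -
    have "h powr (1 - \<theta>) / c = h / (c * h powr \<theta>)"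
      using h by (simp add: powr_diff)
    also have "\<dots> \<le> h / d"
      using dist d h error_bound(1) by (intro divide_left_mono) (auto simp: d_def)
    also have "\<dots> \<le> grad f x \<bullet> (x - w) / d"
      using slope d by (simp add: divide_right_mono)
    also have "\<dots> = - (grad f x \<bullet> z)"
      by (simp add: z_def)
    finally show ?thesis .
  qed
  ultimately show ?thesis by (auto simp: h_def)
qed

section \<open>One step of the method\<close>

text \<open>Both rules lie below the quadratic upper model at every step size: the second minimizes it,
  and exact line search minimizes a function that it majorizes. After this lemma the two options
  need no separate treatment.\<close>

lemma step_le_quadratic_model:
  assumes norm: "is_norm N" and \<Omega>: "convex \<Omega>" "x \<in> \<Omega>" "y \<in> \<Omega>"
    and smooth: "smooth_on_wrt N f \<Omega> L"
    and step: "exact_line_search f x y \<eta> \<or> quadratic_model_step N f L x y \<eta>"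
    and s: "s \<in> {0..1}"
  shows "f (x + \<eta> *\<^sub>R (y - x)) \<le> f x - s * (grad f x \<bullet> (x - y)) + s\<^sup>2 * L / 2 * (N (y - x))\<^sup>2"
proof -
  define m where "m u = u * ((y - x) \<bullet> grad f x) + u\<^sup>2 * L / 2 * (N (y - x))\<^sup>2" for u
  have upper: "f (x + u *\<^sub>R (y - x)) \<le> f x + m u" if "u \<in> {0..1}" for u
  proof -
    have "x + u *\<^sub>R (y - x) = (1 - u) *\<^sub>R x + u *\<^sub>R y"
      by (simp add: algebra_simps)
    then have "x + u *\<^sub>R (y - x) \<in> \<Omega>"
      using convexD[OF \<Omega>, of "1 - u" u] that by simp
    then have "f (x + u *\<^sub>R (y - x)) \<le> f x + grad f x \<bullet> (u *\<^sub>R (y - x))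
        + L / 2 * (N (u *\<^sub>R (y - x)))\<^sup>2"
      using smooth \<Omega>(2) unfolding smooth_on_wrt_def by (metis add_diff_cancel_left')
    also have "N (u *\<^sub>R (y - x)) = u * N (y - x)"
      using norm that unfolding is_norm_def by simp
    finally show ?thesis
      by (simp add: m_def inner_commute power_mult_distrib algebra_simps)
  qed
  have "f (x + \<eta> *\<^sub>R (y - x)) \<le> f x + m s"
    using step
  proof
    assume "exact_line_search f x y \<eta>"
    then have "f (x + \<eta> *\<^sub>R (y - x)) \<le> f (x + s *\<^sub>R (y - x))"
      using s by (auto simp: exact_line_search_def is_arg_min_linorder)
    with upper[OF s] show ?thesis by simp
  next
    assume "quadratic_model_step N f L x y \<eta>"
    then have "\<eta> \<in> {0..1}" "m \<eta> \<le> m s"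
      using s by (auto simp: quadratic_model_step_def is_arg_min_linorder m_def)
    with upper[of \<eta>] show ?thesis by simp
  qed
  then show ?thesis
    by (simp add: m_def inner_commute inner_diff_left algebra_simps)
qed

lemma frank_wolfe_contraction:
  fixes f N :: "'a::euclidean_space \<Rightarrow> real"
  assumes norm: "is_norm N" and convex: "convex_on UNIV f" and diff: "f differentiable (at x)"
    and \<Omega>: "compact \<Omega>" "continuous_on \<Omega> f"
    and strongly_convex: "0 < \<alpha>" "strongly_convex_set N \<alpha> \<Omega>"
    and smooth: "0 < L" "smooth_on_wrt N f \<Omega> L"
    and error_bound: "0 < c" "holder_error_bound N f \<Omega> \<theta> c"
    and x: "x \<in> \<Omega>"
    and y: "is_arg_min (\<lambda>v. grad f x \<bullet> v) (\<lambda>v. v \<in> \<Omega>) y"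
    and step: "exact_line_search f x y \<eta> \<or> quadratic_model_step N f L x y \<eta>"
  shows "f (x + \<eta> *\<^sub>R (y - x)) - min_value f \<Omega>
    \<le> (f x - min_value f \<Omega>) *
       max (1 / 2) (1 - \<alpha> / (8 * c * L) * (f x - min_value f \<Omega>) powr (1 - \<theta>))"
proof -
  define h where "h = f x - min_value f \<Omega>"
  define h' where "h' = f (x + \<eta> *\<^sub>R (y - x)) - min_value f \<Omega>"
  define gap where "gap = grad f x \<bullet> (x - y)"
  define r where "r = N (y - x)"
  define G where "G = h powr (1 - \<theta>) / c"
  obtain w where w: "w \<in> \<Omega>" "min_value f \<Omega> = f w" "\<forall>v\<in>\<Omega>. f w \<le> f v"
    using min_value_attained[OF \<Omega>(1) _ \<Omega>(2)] x by blast
  have y_in: "y \<in> \<Omega>" and y_min: "\<And>v. v \<in> \<Omega> \<Longrightarrow> grad f x \<bullet> y \<le> grad f x \<bullet> v"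
    using y by (auto simp: is_arg_min_linorder)
  have model: "h' \<le> h - s * gap + s\<^sup>2 * L / 2 * r\<^sup>2" if "s \<in> {0..1}" for s
    using step_le_quadratic_model[OF norm _ x y_in smooth(2) step that] strongly_convex(2)
    by (simp add: strongly_convex_set_def h'_def h_def gap_def r_def)
  have "h' \<le> h * max (1 / 2) (1 - \<alpha> / (8 * c * L) * h powr (1 - \<theta>))"
  proof (cases "h = 0")
    case True
    with model[of 0] show ?thesis by simp
  next
    case False
    have h: "0 < h"
      using False w x by (auto simp: h_def order_less_le)
    have "h \<le> gap"
      using convex_on_ge_gradient[OF convex diff, of w] y_min[OF w(1)] w(2)
      by (simp add: h_def gap_def inner_diff_right)
    moreover obtain z where z: "N z = 1" "G \<le> - (grad f x \<bullet> z)"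
      using error_bound_steep_direction[OF norm convex diff \<Omega> error_bound x] h
      by (auto simp: h_def G_def)
    have "\<alpha> / 8 * r\<^sup>2 * G \<le> \<alpha> / 8 * r\<^sup>2 * (- (grad f x \<bullet> z))"
      using z(2) strongly_convex(1) by (intro mult_left_mono) auto
    moreover have "gap / 2 + \<alpha> / 8 * r\<^sup>2 * (- (grad f x \<bullet> z)) \<le> gap"
      using strongly_convex_linear_gap[OF strongly_convex(2) x y z(1)]
      by (simp add: gap_def r_def)
    ultimately have gap: "h / 2 + \<alpha> / 8 * r\<^sup>2 * G \<le> gap" by linarith
    have decrease: "h' \<le> h * (1 - s / 2) + s * r\<^sup>2 / 2 * (s * L - \<alpha> * G / 4)"
      if "s \<in> {0..1}" for s
    proof -
      have "s * (h / 2 + \<alpha> / 8 * r\<^sup>2 * G) \<le> s * gap"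
        using gap that by (intro mult_left_mono) auto
      with model[OF that] show ?thesis
        by (simp add: algebra_simps power2_eq_square)
    qed
    \<comment> \<open>The last bracket vanishes at \<open>s = \<alpha> * G / (4 * L)\<close>; the case distinction is whether this is
      an admissible step size.\<close>
    show ?thesis
    proof (cases "\<alpha> * G / 4 \<le> L")
      case True
      have G: "0 \<le> G"
        using error_bound(1) by (simp add: G_def)
      define s where "s = \<alpha> * G / (4 * L)"
      have s: "s \<in> {0..1}"
        using True G strongly_convex(1) smooth(1) by (simp add: s_def field_simps)
      have "s * L - \<alpha> * G / 4 = 0"
        using smooth(1) by (simp add: s_def)
      with decrease[OF s] have "h' \<le> h * (1 - s / 2)" by simp
      also have "1 - s / 2 = 1 - \<alpha> / (8 * c * L) * h powr (1 - \<theta>)"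
        using error_bound(1) smooth(1) by (simp add: s_def G_def)
      also have "h * \<dots> \<le> h * max (1 / 2) \<dots>"
        using h by (intro mult_left_mono) auto
      finally show ?thesis .
    next
      case False
      have "h' \<le> h * (1 - 1 / 2) + 1 * r\<^sup>2 / 2 * (1 * L - \<alpha> * G / 4)"
        by (rule decrease) simp
      also have "1 * r\<^sup>2 / 2 * (1 * L - \<alpha> * G / 4) \<le> 0"
        using False by (intro mult_nonneg_nonpos) auto
      finally have "h' \<le> h * (1 / 2)" by simp
      also have "\<dots> \<le> h * max (1 / 2) (1 - \<alpha> / (8 * c * L) * h powr (1 - \<theta>))"
        using h by (intro mult_left_mono) auto
      finally show ?thesis .
    qed
  qed
  then show ?thesis by (simp add: h_def h'_def)
qed

text \<open>At the full step the linear term of the model is at most \<open>- h\<close>, because the linear gap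
  dominates the primal gap; what remains is the quadratic term. This is independent of the
  starting point and gives the base case of the induction.\<close>

lemma frank_wolfe_step_le_diameter:
  fixes f N :: "'a::euclidean_space \<Rightarrow> real"
  assumes norm: "is_norm N" and convex: "convex_on UNIV f" and diff: "f differentiable (at x)"
    and \<Omega>: "compact \<Omega>" "continuous_on \<Omega> f" "convex \<Omega>"
    and smooth: "0 < L" "smooth_on_wrt N f \<Omega> L"
    and x: "x \<in> \<Omega>"
    and y: "is_arg_min (\<lambda>v. grad f x \<bullet> v) (\<lambda>v. v \<in> \<Omega>) y"
    and step: "exact_line_search f x y \<eta> \<or> quadratic_model_step N f L x y \<eta>"
  shows "f (x + \<eta> *\<^sub>R (y - x)) - min_value f \<Omega> \<le> L * (diam_wrt N \<Omega>)\<^sup>2 / 2"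
proof -
  obtain w where w: "w \<in> \<Omega>" "min_value f \<Omega> = f w"
    using min_value_attained[OF \<Omega>(1) _ \<Omega>(2)] x by blast
  have y_in: "y \<in> \<Omega>" and y_min: "grad f x \<bullet> y \<le> grad f x \<bullet> w"
    using y w(1) by (auto simp: is_arg_min_linorder)
  have "N (y - x) \<le> diam_wrt N \<Omega>"
    using diam_wrt_attained[OF norm \<Omega>(1)] x y_in by force
  moreover have "0 \<le> N (y - x)"
    using norm by (simp add: is_norm_def)
  ultimately have "(N (y - x))\<^sup>2 \<le> (diam_wrt N \<Omega>)\<^sup>2"
    by (intro power_mono)
  then have "L / 2 * (N (y - x))\<^sup>2 \<le> L / 2 * (diam_wrt N \<Omega>)\<^sup>2"
    using smooth(1) by (intro mult_left_mono) auto
  moreover have "f x - grad f x \<bullet> (x - y) \<le> f w"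
    using convex_on_ge_gradient[OF convex diff, of w] y_min by (simp add: inner_diff_right)
  moreover have "f (x + \<eta> *\<^sub>R (y - x)) \<le> f x - grad f x \<bullet> (x - y) + L / 2 * (N (y - x))\<^sup>2"
    using step_le_quadratic_model[OF norm \<Omega>(3) x y_in smooth(2) step, of 1] by simp
  ultimately show ?thesis using w(2) by simp
qed

lemma frank_wolfe_iterates_in:
  assumes "frank_wolfe step f \<Omega> x" "convex \<Omega>"
    and step: "\<And>u v \<eta>. step u v \<eta> \<Longrightarrow> \<eta> \<in> {0..1}"
  shows "x t \<in> \<Omega>"
proof (induction t)
  case 0
  then show ?case using assms(1) by (simp add: frank_wolfe_def)
next
  case (Suc t)
  from assms(1) obtain y \<eta> where y: "y \<in> \<Omega>" and \<eta>: "\<eta> \<in> {0..1}"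
      and x: "x (Suc t) = x t + \<eta> *\<^sub>R (y - x t)"
    unfolding frank_wolfe_def is_arg_min_linorder using step by blast
  have "x (Suc t) = (1 - \<eta>) *\<^sub>R x t + \<eta> *\<^sub>R y"
    using x by (simp add: algebra_simps)
  then show ?case
    using convexD[OF assms(2) Suc y, of "1 - \<eta>" \<eta>] \<eta> by simp
qed

section \<open>Convergence rates\<close>

theorem theorem1:
  fixes f N :: "'a::euclidean_space \<Rightarrow> real"
    and \<Omega> :: "'a set"
    and x :: "nat \<Rightarrow> 'a"
    and \<alpha> L c \<theta> D f_min C' M \<rho> k C :: real
    and t :: nat
  assumes norm: "is_norm N"
    and convex: "convex_on UNIV f"
    and differentiable: "\<And>v. f differentiable (at v)"
    and nonempty: "\<Omega> \<noteq> {}"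
    and compact: "compact \<Omega>"
    and strongly_convex: "\<alpha> > 0" "strongly_convex_set N \<alpha> \<Omega>"
    and diameter: "D = diam_wrt N \<Omega>"
    and smooth: "L > 0" "smooth_on_wrt N f \<Omega> L"
    and error_bound: "0 \<le> \<theta>" "\<theta> \<le> 1" "0 < c" "holder_error_bound N f \<Omega> \<theta> c"
    and f_min: "f_min = min_value f \<Omega>"
    and iterates: "frank_wolfe (exact_line_search f) f \<Omega> x
                   \<or> frank_wolfe (quadratic_model_step N f L) f \<Omega> x"
    and C': "C' = 1 / (1 - \<theta> - \<theta> * (2 powr (1 - \<theta>) - 1))"
    and M: "M = \<alpha> / (8 * c * L)"
    and \<rho>: "\<rho> = max (1 / 2) (1 - \<alpha> / (8 * c * L))"
    and k: "\<theta> < 1 \<Longrightarrow> k \<ge> max ((2 - 2 powr (1 - \<theta>)) / (2 powr (1 - \<theta>) - 1)) C'"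
    and C: "\<theta> < 1 \<Longrightarrow> C \<ge> max (L * D\<^sup>2 * (1 + k) powr (1 / (1 - \<theta>)) / 2)
                                 (2 * (C' / M) powr (1 / (1 - \<theta>)))"
    and t: "t \<ge> 1"
  shows "f (x t) - f_min \<le>
           (if \<theta> < 1 then C / (real t + k) powr (1 / (1 - \<theta>))
            else \<rho> ^ t * (f (x 0) - f_min))"
proof -
  define h where "h n = f (x n) - f_min" for n
  have cont: "continuous_on \<Omega> f"
    using differentiable
    by (intro continuous_at_imp_continuous_on ballI differentiable_imp_continuous_within)
  have conv: "convex \<Omega>"
    using strongly_convex(2) by (simp add: strongly_convex_set_def)
  have x_in: "x n \<in> \<Omega>" for n
    using iterates frank_wolfe_iterates_in[OF _ conv, of "exact_line_search f"]
      frank_wolfe_iterates_in[OF _ conv, of "quadratic_model_step N f L"]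
    by (auto simp: exact_line_search_def quadratic_model_step_def is_arg_min_linorder)
  have h_nonneg: "0 \<le> h n" for n
    using min_value_attained[OF compact nonempty cont] x_in[of n]
    by (auto simp: h_def f_min)
  have steps: "\<exists>y \<eta>. is_arg_min (\<lambda>v. grad f (x n) \<bullet> v) (\<lambda>v. v \<in> \<Omega>) y
      \<and> (exact_line_search f (x n) y \<eta> \<or> quadratic_model_step N f L (x n) y \<eta>)
      \<and> x (Suc n) = x n + \<eta> *\<^sub>R (y - x n)" for n
    using iterates unfolding frank_wolfe_def by blast
  have contraction: "h (Suc n) \<le> h n * max (1 / 2) (1 - M * h n powr (1 - \<theta>))" for n
    using steps[of n] frank_wolfe_contraction[OF norm convex differentiable compact cont
        strongly_convex smooth error_bound(3,4) x_in]
    by (auto simp: h_def f_min M)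
  have "h t \<le> (if \<theta> < 1 then C / (real t + k) powr (1 / (1 - \<theta>)) else \<rho> ^ t * h 0)"
  proof (cases "\<theta> < 1")
    case False
    then have \<theta>: "\<theta> = 1"
      using error_bound by simp
    have "h n \<le> \<rho> ^ n * h 0" for n
    proof (induction n)
      case (Suc n)
      \<comment> \<open>If \<open>h n = 0\<close>, then \<open>h n powr 0\<close> is \<open>0\<close> instead of \<open>1\<close>, but the factor \<open>h n\<close> makes up for it.\<close>
      have "h (Suc n) \<le> h n * \<rho>"
        using contraction[of n] by (cases "h n = 0") (auto simp: \<theta> \<rho> M)
      also have "\<dots> \<le> \<rho> ^ n * h 0 * \<rho>"
        using Suc by (intro mult_right_mono) (auto simp: \<rho>)
      finally show ?case by (simp add: mult_ac)
    qed simp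
    with False show ?thesis by simp
  next
    case True
    define b where "b = 2 powr (1 - \<theta>) - 1"
    have k_ge: "(2 - 2 powr (1 - \<theta>)) / b \<le> k"
      and C_ge1: "L * D\<^sup>2 * (1 + k) powr (1 / (1 - \<theta>)) / 2 \<le> C"
      and C_ge2: "2 * (C' / M) powr (1 / (1 - \<theta>)) \<le> C"
      using k[OF True] C[OF True] by (auto simp: b_def)
    have b: "0 < b"
      using True by (simp add: b_def)
    have "2 powr (1 - \<theta>) \<le> 2 powr 1"
      using error_bound(1) by (intro powr_mono) auto
    then have "0 \<le> (2 - 2 powr (1 - \<theta>)) / b"
      using b by simp
    then have k_nonneg: "0 \<le> k"
      using k_ge by linarith
    have "2 - 2 powr (1 - \<theta>) \<le> k * b"
      using k_ge b by (simp add: pos_divide_le_eq)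
    \<comment> \<open>This is what the first lower bound on \<open>k\<close> is made for: it holds from \<open>t = 1\<close> on.\<close>
    then have threshold: "1 \<le> (1 + k) * b"
      by (simp add: b_def algebra_simps)
    have "h n \<le> C / (real n + k) powr (1 / (1 - \<theta>))" if "1 \<le> n" for n
      using that
    proof (induction n rule: nat_induct_at_least)
      case base
      have "h 1 \<le> L * D\<^sup>2 / 2"
        using steps[of 0] frank_wolfe_step_le_diameter[OF norm convex differentiable compact cont
            conv smooth x_in]
        by (auto simp: h_def f_min diameter)
      also have "\<dots> \<le> C / (1 + k) powr (1 / (1 - \<theta>))"
        using C_ge1 k_nonneg by (simp add: pos_le_divide_eq)
      finally show ?case by simp
    next
      case (Suc n)
      have "(1 + k) * b \<le> (real n + k) * b"
        using Suc.hyps b by (intro mult_right_mono) auto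
      then have "1 \<le> (real n + k) * (2 powr (1 - \<theta>) - 1)"
        using threshold by (simp add: b_def)
      moreover have "0 < real n + k"
        using Suc.hyps k_nonneg by simp
      moreover have "0 < M"
        using strongly_convex(1) smooth(1) error_bound(3) by (simp add: M)
      moreover have "1 / (1 - \<theta>) \<le> C'"
        using rate_constant_ge[OF error_bound(1) True] by (simp add: C')
      ultimately have "h (Suc n) \<le> C / (real n + k + 1) powr (1 / (1 - \<theta>))"
        using error_bound(1) True C_ge2 h_nonneg Suc.IH contraction
        by (intro contraction_power_rate_step
            [where s = "real n + k" and M = M and B = C' and h = "h n"]) auto
      then show ?case by (simp add: algebra_simps)
    qed
    with t True show ?thesis by simp
  qed
  then show ?thesis unfolding h_def .
qed

end
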